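(* For every $\pi$ in the alternating group $A_n$, $\ell_2(\pi)$ is the length of $\pi$ with respect to the set of generators $\{a_1,\dots,a_{n-2}\}\subset A_n$, where $a_i:=s_1s_{i+1}$; that is, $\ell_2(\pi)$ is the smallest $r$ such that $\pi$ is a product of $r$ elements of $\{a_1^{\pm1},\dots,a_{n-2}^{\pm 1}\}$.
   Context: Permutations in $S_n$ are multiplied as functions: $(\sigma\tau)(i)=\sigma(\tau(i))$. Let $s_i=(i,i+1)$, $1\le i\le n-1$. $A_n\subset S_n$ is the subgroup of even permutations; the elements $a_i=s_1s_{i+1}$, $1\le i\le n-2$, generate it. Canonical presentation: for $1\le j\le n-1$ let $R_j=\{1,\ s_j,\ s_js_{j-1},\ \ldots,\ s_js_{j-1}\cdots s_1\}$. Every $w\in S_n$ can be written uniquely as $w=w_1w_2\cdots w_{n-1}$ with $w_j\in R_j$; this product, regarded as a word in the $s_i$ (each $w_j$ being spelled as displayed in $R_j$), is the canonical presentation of $w$. The $2$-length $\ell_2(\pi)$ is the number of letters in the canonical presentation of $\pi$ where the letter $s_1$ is not counted (i.e. the number of letters $s_i$ with $i\ge 2$, counted with multiplicity). *)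

theory Defs
  imports "HOL-Algebra.Sym_Groups"
begin

text \<open>
  Permutations of \<open>{1..n}\<close> are functions \<open>nat \<Rightarrow> nat\<close> that are the identity outside \<open>{1..n}\<close>,
  multiplied by composition, as in \<^const>\<open>alt_group\<close>.
\<close>

definition adj_transp :: "nat \<Rightarrow> nat \<Rightarrow> nat" where
  "adj_transp i = transpose i (i + 1)"

text \<open>The word \<open>[i1, ..., ik]\<close> spells the product \<open>s_i1 \<circ> ... \<circ> s_ik\<close> (rightmost factor acts first).\<close>

definition word_perm :: "nat list \<Rightarrow> nat \<Rightarrow> nat" where
  "word_perm u = foldr (\<circ>) (map adj_transp u) id"

text \<open>\<open>R_j\<close> as a set of words: the empty word and \<open>[j, j - 1, ..., k]\<close> for \<open>1 \<le> k \<le> j\<close>.\<close>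

definition R_words :: "nat \<Rightarrow> nat list set" where
  "R_words j = insert [] {rev [k..<j + 1] | k. 1 \<le> k \<and> k \<le> j}"

text \<open>
  \<open>ws = [w_1, ..., w_(n-1)]\<close>, one block \<open>w_j\<close> from \<open>R_j\<close> for each \<open>j\<close>; list positions start at 0.
\<close>

definition is_canonical_word :: "nat \<Rightarrow> (nat \<Rightarrow> nat) \<Rightarrow> nat list \<Rightarrow> bool" where
  "is_canonical_word n p u \<longleftrightarrow>
     (\<exists>ws. length ws = n - 1 \<and> (\<forall>j\<in>{1..n - 1}. ws ! (j - 1) \<in> R_words j) \<and>
           u = concat ws \<and> word_perm u = p)"

text \<open>For \<open>p\<close> permuting \<open>{1..n}\<close> such a word exists and is unique.\<close>

definition canonical_word :: "nat \<Rightarrow> (nat \<Rightarrow> nat) \<Rightarrow> nat list" where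
  "canonical_word n p = (THE u. is_canonical_word n p u)"

definition two_length :: "nat \<Rightarrow> (nat \<Rightarrow> nat) \<Rightarrow> nat" where
  "two_length n p = length (filter (\<lambda>i. i \<noteq> 1) (canonical_word n p))"

definition alt_gen :: "nat \<Rightarrow> nat \<Rightarrow> nat" where
  "alt_gen i = adj_transp 1 \<circ> adj_transp (i + 1)"

text \<open>\<open>g\<close> is a product of \<open>r\<close> elements of \<open>S \<union> S\<^sup>-\<^sup>1\<close>; the empty product is the identity.\<close>

definition is_product_of :: "('a, 'b) monoid_scheme \<Rightarrow> 'a set \<Rightarrow> nat \<Rightarrow> 'a \<Rightarrow> bool" where
  "is_product_of G S r g \<longleftrightarrow>
     (\<exists>xs. length xs = r \<and> set xs \<subseteq> S \<union> (\<lambda>x. inv\<^bsub>G\<^esub> x) ` S \<and>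
           foldr (\<otimes>\<^bsub>G\<^esub>) xs \<one>\<^bsub>G\<^esub> = g)"

text \<open>
  Relational rather than a \<^const>\<open>Least\<close> term, so that having a length includes being
  generated by \<open>S\<close>.
\<close>

definition has_gen_length :: "('a, 'b) monoid_scheme \<Rightarrow> 'a set \<Rightarrow> 'a \<Rightarrow> nat \<Rightarrow> bool" where
  "has_gen_length G S g r \<longleftrightarrow>
     is_product_of G S r g \<and> (\<forall>r'. is_product_of G S r' g \<longrightarrow> r \<le> r')"

end

theory Submission
  imports Defs
begin

text \<open>
  The two lengths agree because both equal the least number of letters other than \<open>s_1\<close> in any word
  for \<open>p\<close>.

  On the one hand, each generator \<open>s_1 s_j\<close> and each inverse \<open>s_j s_1\<close> contributes exactly one letter
  other than \<open>s_1\<close>. Conversely every word spelling an even permutation regroups into as many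
  generators as it has such letters: reading from the left and carrying along at most one \<open>s_1\<close>, each
  letter \<open>s_j\<close> with \<open>j \<ge> 2\<close> either absorbs the carried \<open>s_1\<close>, as \<open>s_1 s_j\<close>, or creates a new one,
  as \<open>s_j = (s_j s_1) s_1\<close>; evenness leaves no \<open>s_1\<close> at the end
  (\<open>word_perm_as_gen_product\<close>).

  On the other hand, canonical words minimise the number of such letters. For \<open>q = p\<^sup>-\<^sup>1\<close> let \<open>c_m\<close>
  be the number of inversions of \<open>q\<close> whose right position is \<open>m\<close>, and consider the truncated
  inversion number, the sum of all \<open>min c_m (m - 2)\<close>. Composing \<open>q\<close> with \<open>s_j\<close> on the right changes
  it by at most \<open>1\<close>, and not at all if \<open>j = 1\<close> (\<open>trunc_inv_adj_transp\<close>); so it is a lower bound for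
  every word. On a canonical word the bound is attained (\<open>trunc_inv_canonical\<close>): the block \<open>w_j\<close> has
  \<open>c_(j+1)\<close> letters, one of which is \<open>s_1\<close> exactly if \<open>c_(j+1)\<close> has its largest possible value \<open>j\<close>.
\<close>

section \<open>Words in the adjacent transpositions\<close>

text \<open>
  Products are simplified as elements of a group and evaluated at points only on request.
\<close>

declare comp_apply [simp del] id_apply [simp del]

abbreviation count_non1 :: "nat list \<Rightarrow> nat" where
  "count_non1 u \<equiv> length (filter (\<lambda>i. i \<noteq> 1) u)"

lemma adj_transp_simps [simp]:
  "adj_transp j j = Suc j" "adj_transp j (Suc j) = j"
  "m \<noteq> j \<Longrightarrow> m \<noteq> Suc j \<Longrightarrow> adj_transp j m = m"
  by (auto simp: adj_transp_def transpose_def)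

lemma adj_transp_involutory [simp]: "adj_transp j \<circ> adj_transp j = id"
  by (simp add: adj_transp_def)

lemma word_perm_simps [simp]:
  "word_perm [] = id"
  "word_perm (j # u) = adj_transp j \<circ> word_perm u"
  by (simp_all add: word_perm_def comp_apply id_apply)

lemma word_perm_append [simp]: "word_perm (u @ v) = word_perm u \<circ> word_perm v"
  by (induction u) (simp_all add: comp_assoc)

lemma word_perm_concat: "word_perm (concat us) = foldr (\<circ>) (map word_perm us) id"
  by (induction us) (simp_all add: comp_apply id_apply)

lemma word_perm_rev_left: "word_perm (rev u) \<circ> word_perm u = id"
proof (induction u)
  case (Cons j u)
  have "word_perm (rev (j # u)) \<circ> word_perm (j # u)
        = word_perm (rev u) \<circ> (adj_transp j \<circ> adj_transp j) \<circ> word_perm u"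
    by (simp add: comp_assoc del: adj_transp_involutory)
  also have "\<dots> = id" using Cons by simp
  finally show ?case .
qed simp

lemma word_perm_rev_right: "word_perm u \<circ> word_perm (rev u) = id"
  using word_perm_rev_left[of "rev u"] by simp

lemma bij_word_perm: "bij (word_perm u)"
  using word_perm_rev_left word_perm_rev_right o_bij by blast

lemma word_perm_permutes: "set u \<subseteq> {1..<n} \<Longrightarrow> word_perm u permutes {1..n}"
proof (induction u)
  case (Cons j u)
  then have "adj_transp j permutes {1..n}"
    unfolding adj_transp_def by (intro permutes_swap_id) auto
  with Cons show ?case by (auto intro: permutes_compose)
qed (simp add: permutes_id)

lemma evenperm_word_perm: "permutation (word_perm u) \<and> (evenperm (word_perm u) \<longleftrightarrow> even (length u))"
proof (induction u)
  case (Cons j u)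
  have "permutation (adj_transp j)" "\<not> evenperm (adj_transp j)"
    by (simp_all add: adj_transp_def permutation_swap_id evenperm_swap)
  with Cons show ?case
    by (auto simp: permutation_compose evenperm_comp)
qed (simp_all add: evenperm_id)

text \<open>
  With \<open>l = n + 1\<close> this is the inverse of the block \<open>s_n ... s_k\<close>, which therefore takes \<open>k\<close> to
  \<open>n + 1\<close>.
\<close>

lemma word_perm_upt:
  assumes "k \<le> l"
  shows "word_perm [k..<l] i = (if i = l then k else if k \<le> i \<and> i < l then Suc i else i)"
  using assms
proof (induction l arbitrary: i rule: dec_induct)
  case (step l)
  consider "i = l" | "i = Suc l" | "i \<noteq> l" "i \<noteq> Suc l" by blast
  then show ?case using step by cases (auto simp: comp_apply)
qed (simp add: id_apply)

section \<open>Canonical words\<close>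

lemma R_words_altdef: "R_words j = {rev [k..<Suc j] | k. 1 \<le> k \<and> k \<le> Suc j}"
proof -
  have "[] = rev [Suc j..<Suc j]" by simp
  then show ?thesis
    unfolding R_words_def by (fastforce simp: le_Suc_eq simp del: upt_Suc)
qed

lemma is_canonical_word_0: "is_canonical_word 0 p u \<longleftrightarrow> u = [] \<and> p = id"
  by (auto simp: is_canonical_word_def)

lemma word_perm_canonical: "is_canonical_word n p u \<Longrightarrow> word_perm u = p"
  by (auto simp: is_canonical_word_def)

text \<open>
  Splitting off the last block reduces \<open>n + 1\<close> to \<open>n\<close>; an empty block corresponds to \<open>k = n + 1\<close>.
\<close>

lemma is_canonical_word_Suc:
  "is_canonical_word (Suc n) p u \<longleftrightarrow>
    (\<exists>v k. 1 \<le> k \<and> k \<le> Suc n \<and> u = v @ rev [k..<Suc n] \<and>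
           is_canonical_word n (word_perm v) v \<and> word_perm u = p)"
    (is "?L \<longleftrightarrow> ?R")
proof (cases "n = 0")
  case True
  have "1 \<le> k \<and> k \<le> Suc 0 \<longleftrightarrow> k = 1" for k by auto
  with True show ?thesis by (auto simp: is_canonical_word_def simp flip: conj_assoc)
next
  case False
  then have n: "1 \<le> n" by simp
  show ?thesis
  proof
    assume ?L
    then obtain ws where ws: "length ws = n" "\<forall>j\<in>{1..n}. ws ! (j - 1) \<in> R_words j"
        "u = concat ws" "word_perm u = p"
      by (auto simp: is_canonical_word_def)
    from ws(1) n obtain vs w where vs: "ws = vs @ [w]" "length vs = n - 1"
      by (cases ws rule: rev_cases) auto
    have "w \<in> R_words n" using ws(2)[rule_format, of n] vs n by (simp add: nth_append)
    then obtain k where k: "1 \<le> k" "k \<le> Suc n" "w = rev [k..<Suc n]"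
      unfolding R_words_altdef by blast
    have "vs ! (j - 1) \<in> R_words j" if "j \<in> {1..n - 1}" for j
    proof -
      have "j - 1 < length vs" "j \<in> {1..n}" using vs that by auto
      then show ?thesis using ws(2) vs by (metis nth_append_left)
    qed
    then have "is_canonical_word n (word_perm (concat vs)) (concat vs)"
      unfolding is_canonical_word_def using vs by blast
    moreover have "u = concat vs @ rev [k..<Suc n]" using ws vs k by (simp del: upt_Suc)
    ultimately show ?R using ws(4) k by blast
  next
    assume ?R
    then obtain v k vs where v: "1 \<le> k" "k \<le> Suc n" "u = v @ rev [k..<Suc n]" "word_perm u = p"
        "length vs = n - 1" "\<forall>j\<in>{1..n - 1}. vs ! (j - 1) \<in> R_words j" "v = concat vs"
      by (auto simp: is_canonical_word_def simp del: upt_Suc)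
    have "rev [k..<Suc n] \<in> R_words n" using v by (auto simp: R_words_altdef simp del: upt_Suc)
    then have "(vs @ [rev [k..<Suc n]]) ! (j - 1) \<in> R_words j" if "j \<in> {1..n}" for j
      using v that by (cases "j = n") (auto simp: nth_append simp del: upt_Suc)
    moreover have "u = concat (vs @ [rev [k..<Suc n]])" using v by simp
    moreover have "length (vs @ [rev [k..<Suc n]]) = n" using v n by simp
    ultimately show ?L unfolding is_canonical_word_def diff_Suc_1 using v(4) by blast
  qed
qed

lemma canonical_word_induct [consumes 1, case_names empty insert]:
  assumes "is_canonical_word n p u"
    and "P 0 []"
    and "\<And>n k v. \<lbrakk>1 \<le> k; k \<le> Suc n; is_canonical_word n (word_perm v) v; P n v\<rbrakk>
      \<Longrightarrow> P (Suc n) (v @ rev [k..<Suc n])"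
  shows "P n u"
  using assms(1)
proof (induction n arbitrary: p u)
  case 0
  then show ?case using assms(2) by (simp add: is_canonical_word_0)
next
  case (Suc n)
  then obtain v k where "1 \<le> k" "k \<le> Suc n" "u = v @ rev [k..<Suc n]"
      "is_canonical_word n (word_perm v) v"
    unfolding is_canonical_word_Suc by blast
  then show ?case using assms(3)[of k n v] Suc.IH by (simp del: upt_Suc)
qed

lemma set_canonical_word: "is_canonical_word n p u \<Longrightarrow> set u \<subseteq> {1..<n}"
  by (induction rule: canonical_word_induct) (auto simp del: upt_Suc)

lemma ex_canonical_word: "p permutes {1..n} \<Longrightarrow> \<exists>u. is_canonical_word n p u"
proof (induction n arbitrary: p)
  case 0
  then show ?case by (simp add: is_canonical_word_0)
next
  case (Suc n)
  \<comment> \<open>The last block is found from the preimage \<open>k\<close> of \<open>n + 1\<close>; removing it makes \<open>n + 1\<close> fixed.\<close>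
  from Suc.prems have "Suc n \<in> p ` {1..Suc n}" by (simp add: permutes_image)
  then obtain k where k: "1 \<le> k" "k \<le> Suc n" "p k = Suc n" by auto
  let ?b = "[k..<Suc n]"
  define q where "q = p \<circ> word_perm ?b"
  have "word_perm ?b permutes {1..Suc n}" using k by (intro word_perm_permutes) auto
  then have "q permutes {1..Suc n}"
    unfolding q_def using Suc.prems by (intro permutes_compose)
  moreover have "q (Suc n) = Suc n"
    using k by (simp add: q_def comp_apply word_perm_upt del: upt_Suc)
  ultimately have "q permutes {1..n}"
    by (elim permutes_superset) (auto simp: le_Suc_eq)
  then obtain v where v: "is_canonical_word n q v" using Suc.IH by blast
  then have q: "word_perm v = q" by (rule word_perm_canonical)
  have "word_perm (v @ rev ?b) = p \<circ> (word_perm ?b \<circ> word_perm (rev ?b))"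
    by (simp add: q q_def comp_assoc del: upt_Suc)
  then have "word_perm (v @ rev ?b) = p" by (simp add: word_perm_rev_right del: upt_Suc)
  then have "is_canonical_word (Suc n) p (v @ rev ?b)"
    using k v q by (subst is_canonical_word_Suc) (auto simp del: upt_Suc)
  then show ?case by blast
qed

lemma word_perm_last_block:
  assumes "set v \<subseteq> {1..<n}" and "k \<le> Suc n"
  shows "word_perm (v @ rev [k..<Suc n]) k = Suc n"
proof -
  have "word_perm [k..<Suc n] (Suc n) = k" using assms by (simp add: word_perm_upt del: upt_Suc)
  then have "word_perm (rev [k..<Suc n]) k = Suc n"
    using word_perm_rev_left[of "[k..<Suc n]"] by (metis comp_apply id_apply)
  moreover have "word_perm v (Suc n) = Suc n"
    using word_perm_permutes[OF assms(1)] by (simp add: permutes_not_in)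
  ultimately show ?thesis by (simp add: comp_apply del: upt_Suc)
qed

lemma canonical_word_unique:
  assumes "is_canonical_word n p u" and "is_canonical_word n p u'"
  shows "u = u'"
proof -
  have "word_perm u' = word_perm u \<Longrightarrow> is_canonical_word n (word_perm u') u' \<Longrightarrow> u' = u"
    using assms(1)
  proof (induction arbitrary: u' rule: canonical_word_induct)
    case empty
    then show ?case by (simp add: is_canonical_word_0)
  next
    case (insert n k v)
    from insert.prems(2) obtain v' k' where v': "1 \<le> k'" "k' \<le> Suc n"
        "u' = v' @ rev [k'..<Suc n]" "is_canonical_word n (word_perm v') v'"
      unfolding is_canonical_word_Suc by blast
    \<comment> \<open>In both words the last letter of the last block is the preimage of \<open>n + 1\<close>, or the block is empty.\<close>
    have "word_perm u' k' = word_perm u' k"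
      using word_perm_last_block[OF set_canonical_word] insert v' by metis
    then have k: "k' = k" by (meson bij_word_perm bij_is_inj injD)
    have "word_perm v' \<circ> word_perm (rev [k..<Suc n]) = word_perm v \<circ> word_perm (rev [k..<Suc n])"
      using insert.prems(1) v'(3) k by (simp del: upt_Suc)
    then have "word_perm v' = word_perm v"
      by (metis comp_assoc comp_id word_perm_rev_left)
    then show ?case using insert.IH v' k by simp
  qed
  moreover have "word_perm u = p" "word_perm u' = p"
    using assms by (simp_all add: word_perm_canonical)
  ultimately show ?thesis using assms by simp
qed

lemma canonical_word_canonical:
  "p permutes {1..n} \<Longrightarrow> is_canonical_word n p (canonical_word n p)"
  unfolding canonical_word_def using ex_canonical_word canonical_word_unique by (metis theI)

section \<open>The truncated inversion number\<close>

definition inv_at :: "(nat \<Rightarrow> nat) \<Rightarrow> nat \<Rightarrow> nat" where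
  "inv_at q m = card {v \<in> {1..<m}. q m < q v}"

text \<open>
  The truncation at \<open>m - 2\<close> only affects \<open>inv_at q m = m - 1\<close>, that is, the left-to-right minima of
  \<open>q\<close> at positions \<open>m \<ge> 2\<close>. The summand for \<open>m = 1\<close> is zero.
\<close>

definition trunc_inv :: "nat \<Rightarrow> (nat \<Rightarrow> nat) \<Rightarrow> nat" where
  "trunc_inv n q = (\<Sum>m=1..n. min (inv_at q m) (m - 2))"

lemma inv_at_le: "inv_at q m \<le> m - 1"
proof -
  have "inv_at q m \<le> card {1..<m}" unfolding inv_at_def by (intro card_mono) auto
  then show ?thesis by simp
qed

lemma inv_at_antimono_step:
  assumes "q j < q (Suc j)"
  shows "inv_at q (Suc j) \<le> inv_at q j"
  unfolding inv_at_def using assms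
  by (intro card_mono) (auto simp: less_Suc_eq)

lemma inv_at_adj_transp:
  assumes "1 \<le> j" and "q j < q (Suc j)"
  shows "inv_at (q \<circ> adj_transp j) j = inv_at q (Suc j)"
    and "inv_at (q \<circ> adj_transp j) (Suc j) = Suc (inv_at q j)"
    and "m \<noteq> j \<Longrightarrow> m \<noteq> Suc j \<Longrightarrow> inv_at (q \<circ> adj_transp j) m = inv_at q m"
proof -
  have "{v \<in> {1..<j}. (q \<circ> adj_transp j) j < (q \<circ> adj_transp j) v}
        = {v \<in> {1..<Suc j}. q (Suc j) < q v}"
    using assms by (auto simp: comp_apply less_Suc_eq)
  then show "inv_at (q \<circ> adj_transp j) j = inv_at q (Suc j)" by (simp add: inv_at_def)
next
  have "{v \<in> {1..<Suc j}. (q \<circ> adj_transp j) (Suc j) < (q \<circ> adj_transp j) v}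
        = insert j {v \<in> {1..<j}. q j < q v}"
    using assms by (auto simp: comp_apply less_Suc_eq)
  then show "inv_at (q \<circ> adj_transp j) (Suc j) = Suc (inv_at q j)" by (simp add: inv_at_def)
next
  assume m: "m \<noteq> j" "m \<noteq> Suc j"
  let ?A = "{v \<in> {1..<m}. q m < q v}"
  have inv: "adj_transp j (adj_transp j v) = v" for v
    by (metis adj_transp_involutory comp_apply id_apply)
  have mem: "adj_transp j v \<in> {1..<m} \<longleftrightarrow> v \<in> {1..<m}" for v
    using m assms(1) by (cases "v = j"; cases "v = Suc j") auto
  have "{v \<in> {1..<m}. (q \<circ> adj_transp j) m < (q \<circ> adj_transp j) v} = adj_transp j ` ?A"
    (is "?B = _")
  proof
    show "?B \<subseteq> adj_transp j ` ?A"
    proof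
      fix v assume "v \<in> ?B"
      then have "adj_transp j v \<in> ?A" using mem m by (simp add: comp_apply)
      then show "v \<in> adj_transp j ` ?A" using inv by (metis image_eqI)
    qed
    show "adj_transp j ` ?A \<subseteq> ?B" using mem inv m by (auto simp: comp_apply)
  qed
  moreover have "inj_on (adj_transp j) ?A" using inv by (metis inj_onI)
  ultimately show "inv_at (q \<circ> adj_transp j) m = inv_at q m"
    by (simp add: inv_at_def card_image)
qed

text \<open>
  With \<open>a = c_j\<close> and \<open>b = c_(j+1)\<close>, where \<open>b \<le> a \<le> j - 1\<close>, only the summands at \<open>j\<close> and \<open>j + 1\<close>
  change, from \<open>min a (j - 2) + min b (j - 1)\<close> to \<open>min b (j - 2) + min (a + 1) (j - 1)\<close>. For
  \<open>j \<ge> 2\<close> the entry \<open>a\<close> rises together with its cut-off, a gain of exactly one, while the cut-off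
  of \<open>b\<close> drops, a loss of at most one. For \<open>j = 1\<close> all four summands vanish.
\<close>

lemma trunc_inv_ascent:
  assumes "1 \<le> j" "j < n" "q j < q (Suc j)"
  defines "q' \<equiv> q \<circ> adj_transp j"
  shows "trunc_inv n q \<le> trunc_inv n q' + (if j = 1 then 0 else 1)"
    and "trunc_inv n q' \<le> trunc_inv n q + (if j = 1 then 0 else 1)"
proof -
  let ?I = "{1..n} - {j, Suc j}"
  have split: "trunc_inv n f = min (inv_at f j) (j - 2) + min (inv_at f (Suc j)) (Suc j - 2)
                 + (\<Sum>m\<in>?I. min (inv_at f m) (m - 2))" for f
  proof -
    have "{1..n} = insert j (insert (Suc j) ?I)" using assms by auto
    then have "trunc_inv n f = (\<Sum>m\<in>insert j (insert (Suc j) ?I). min (inv_at f m) (m - 2))"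
      by (simp add: trunc_inv_def)
    then show ?thesis by simp
  qed
  have "(\<Sum>m\<in>?I. min (inv_at q' m) (m - 2)) = (\<Sum>m\<in>?I. min (inv_at q m) (m - 2))"
    unfolding q'_def using assms by (intro sum.cong) (simp_all add: inv_at_adj_transp)
  then have "trunc_inv n q' = min (inv_at q (Suc j)) (j - 2) + min (Suc (inv_at q j)) (Suc j - 2)
      + (\<Sum>m\<in>?I. min (inv_at q m) (m - 2))"
    unfolding split[of q'] using assms by (simp add: inv_at_adj_transp q'_def)
  moreover note split[of q]
  moreover have "inv_at q (Suc j) \<le> inv_at q j" "inv_at q j \<le> j - 1"
    using assms inv_at_antimono_step inv_at_le by auto
  ultimately show "trunc_inv n q \<le> trunc_inv n q' + (if j = 1 then 0 else 1)"
    and "trunc_inv n q' \<le> trunc_inv n q + (if j = 1 then 0 else 1)"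
    using assms(1) by (auto simp: min_def split: if_splits)
qed

lemma trunc_inv_adj_transp:
  assumes "1 \<le> j" "j < n" "inj q"
  shows "trunc_inv n (q \<circ> adj_transp j) \<le> trunc_inv n q + (if j = 1 then 0 else 1)"
proof -
  have "q j \<noteq> q (Suc j)" using assms(3) by (simp add: inj_eq)
  then consider "q j < q (Suc j)" | "q (Suc j) < q j" by linarith
  then show ?thesis
  proof cases
    case 1
    then show ?thesis using trunc_inv_ascent(2) assms by blast
  next
    case 2
    then show ?thesis
      using trunc_inv_ascent(1)[of j n "q \<circ> adj_transp j"] assms
      by (simp add: comp_assoc comp_apply)
  qed
qed

lemma trunc_inv_id: "trunc_inv n id = 0"
proof -
  have "inv_at id m = 0" for m by (auto simp: inv_at_def id_apply)
  then show ?thesis by (simp add: trunc_inv_def)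
qed

lemma trunc_inv_le_count_non1:
  "set u \<subseteq> {1..<n} \<Longrightarrow> trunc_inv n (word_perm u) \<le> count_non1 u"
proof (induction u rule: rev_induct)
  case (snoc j u)
  have "trunc_inv n (word_perm u \<circ> adj_transp j)
        \<le> trunc_inv n (word_perm u) + (if j = 1 then 0 else 1)"
    using snoc.prems by (intro trunc_inv_adj_transp bij_is_inj bij_word_perm) auto
  then show ?case using snoc by (auto split: if_splits)
qed (simp add: trunc_inv_id)

lemma count_non1_upt:
  assumes "1 \<le> k" "k \<le> Suc n"
  shows "count_non1 [k..<Suc n] = min (Suc n - k) (n - 1)"
proof -
  have "filter (\<lambda>i. i \<noteq> 1) [k..<Suc n] = filter (\<lambda>i. i \<noteq> 1) [max 2 k..<Suc n]"
  proof (cases "k = 1")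
    case True
    have "filter (\<lambda>i. i \<noteq> 1) [1..<Suc n] = filter (\<lambda>i. i \<noteq> 1) [2..<Suc n]"
      by (cases "n = 0") (simp_all add: upt_conv_Cons numeral_2_eq_2 del: upt_Suc)
    moreover have "max 2 k = 2" using True by simp
    ultimately show ?thesis using True by (simp only:)
  next
    case False
    with assms have "max 2 k = k" by simp
    then show ?thesis by simp
  qed
  also have "\<dots> = [max 2 k..<Suc n]" by (intro filter_True) auto
  finally show ?thesis using assms by (simp del: upt_Suc)
qed

text \<open>
  Prefixing the inverse block to \<open>q\<close> keeps the relative order of the values at the positions
  \<open>1, ..., n\<close>, and moves the value at \<open>n + 1\<close> below exactly the \<open>n + 1 - k\<close> values \<open>k, ..., n\<close>.
\<close>

lemma trunc_inv_insert:
  assumes "q permutes {1..n}" "1 \<le> k" "k \<le> Suc n"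
  shows "trunc_inv (Suc n) (word_perm [k..<Suc n] \<circ> q) = trunc_inv n q + count_non1 [k..<Suc n]"
proof -
  define q' where "q' = word_perm [k..<Suc n] \<circ> q"
  have in_range: "q v \<in> {1..n}" if "v \<in> {1..n}" for v
    using that assms(1) by (simp only: permutes_in_image)
  have q': "q' v = (if k \<le> q v then Suc (q v) else q v)" if "v \<in> {1..n}" for v
    using in_range[OF that] assms by (auto simp: q'_def comp_apply word_perm_upt simp del: upt_Suc)
  have last: "q' (Suc n) = k"
    using assms by (simp add: q'_def comp_apply word_perm_upt permutes_not_in del: upt_Suc)
  have old: "inv_at q' m = inv_at q m" if "m \<in> {1..n}" for m
  proof -
    have "{v \<in> {1..<m}. q' m < q' v} = {v \<in> {1..<m}. q m < q v}"
      using that q' by (intro Collect_cong) (auto split: if_splits)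
    then show ?thesis by (simp add: inv_at_def)
  qed
  have "q' (Suc n) < q' v \<longleftrightarrow> q v \<in> {k..n}" if "v \<in> {1..n}" for v
    using q'[OF that] in_range[OF that] last by auto
  then have "{v \<in> {1..<Suc n}. q' (Suc n) < q' v} = {v \<in> {1..n}. q v \<in> {k..n}}"
    unfolding atLeastLessThanSuc_atLeastAtMost by blast
  moreover have "bij_betw q {v \<in> {1..n}. q v \<in> {k..n}} {k..n}"
  proof (rule bij_betw_imageI)
    show "inj_on q {v \<in> {1..n}. q v \<in> {k..n}}"
      using assms(1) by (meson inj_on_subset permutes_inj subset_UNIV)
    have "{k..n} \<subseteq> q ` {1..n}" using assms by (auto simp: permutes_image)
    then show "q ` {v \<in> {1..n}. q v \<in> {k..n}} = {k..n}" by blast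
  qed
  ultimately have "inv_at q' (Suc n) = Suc n - k"
    by (simp add: inv_at_def bij_betw_same_card)
  moreover have "trunc_inv (Suc n) q'
      = (\<Sum>m=1..n. min (inv_at q' m) (m - 2)) + min (inv_at q' (Suc n)) (n - 1)"
    by (simp add: trunc_inv_def)
  moreover have "(\<Sum>m=1..n. min (inv_at q' m) (m - 2)) = trunc_inv n q"
    unfolding trunc_inv_def using old by (intro sum.cong) auto
  ultimately show ?thesis using assms count_non1_upt by (simp add: q'_def del: upt_Suc)
qed

lemma trunc_inv_canonical:
  "is_canonical_word n p u \<Longrightarrow> trunc_inv n (word_perm (rev u)) = count_non1 u"
proof (induction rule: canonical_word_induct)
  case empty
  then show ?case by (simp add: trunc_inv_id)
next
  case (insert n k v)
  have "word_perm (rev v) permutes {1..n}"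
    using set_canonical_word[OF insert.hyps(3)] by (intro word_perm_permutes) simp
  from trunc_inv_insert[OF this insert.hyps(1,2)] insert.IH show ?case
    by (simp add: rev_filter[symmetric] del: upt_Suc)
qed

text \<open>
  The inverse of \<open>p\<close> is spelled by the reversal of any word for \<open>p\<close>, so the canonical word, where
  the truncated inversion number is attained, can be compared with \<open>u\<close>, where it is a lower bound.
\<close>

lemma two_length_le_count_non1:
  assumes "set u \<subseteq> {1..<n}"
  shows "two_length n (word_perm u) \<le> count_non1 u"
proof -
  let ?c = "canonical_word n (word_perm u)"
  have c: "is_canonical_word n (word_perm u) ?c"
    using assms by (intro canonical_word_canonical word_perm_permutes)
  then have "word_perm ?c = word_perm u" by (rule word_perm_canonical)
  then have "word_perm (rev ?c) = word_perm (rev u)"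
    by (metis comp_assoc comp_id id_comp word_perm_rev_left word_perm_rev_right)
  then have "two_length n (word_perm u) = trunc_inv n (word_perm (rev u))"
    using trunc_inv_canonical[OF c] by (simp add: two_length_def)
  also have "\<dots> \<le> count_non1 (rev u)" using assms by (intro trunc_inv_le_count_non1) simp
  also have "\<dots> = count_non1 u" by (simp add: rev_filter[symmetric])
  finally show ?thesis .
qed

section \<open>Words and products of the generators\<close>

lemma alt_gen_carrier:
  assumes "i \<in> {1..n - 2}"
  shows "word_perm [1, Suc i] \<in> carrier (alt_group n)" "word_perm [Suc i, 1] \<in> carrier (alt_group n)"
proof -
  from assms have "1 \<in> {1..<n}" "Suc i \<in> {1..<n}" by auto
  then show "word_perm [1, Suc i] \<in> carrier (alt_group n)"
    and "word_perm [Suc i, 1] \<in> carrier (alt_group n)"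
    using word_perm_permutes evenperm_word_perm by (simp_all add: alt_group_carrier del: word_perm_simps)
qed

lemma alt_gens_with_inverses:
  "alt_gen ` {1..n - 2} \<union> (\<lambda>x. inv\<^bsub>alt_group n\<^esub> x) ` (alt_gen ` {1..n - 2})
   = word_perm ` (\<Union>i\<in>{1..n - 2}. {[1, Suc i], [Suc i, 1]})"
proof -
  have gen: "alt_gen i = word_perm [1, Suc i]" for i by (simp add: alt_gen_def)
  have "inv\<^bsub>alt_group n\<^esub> (alt_gen i) = word_perm [Suc i, 1]" if "i \<in> {1..n - 2}" for i
  proof (rule group.inv_equality[OF alt_group_is_group])
    show "word_perm [Suc i, 1] \<otimes>\<^bsub>alt_group n\<^esub> alt_gen i = \<one>\<^bsub>alt_group n\<^esub>"
      using word_perm_rev_left[of "[1, Suc i]"] gen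
      by (simp add: alt_group_mult alt_group_one)
  qed (use alt_gen_carrier that gen in simp_all)
  then show ?thesis by (auto simp: gen image_UN image_image simp del: word_perm_simps)
qed

text \<open>The flag \<open>e\<close> says whether an \<open>s_1\<close> is carried along from the left.\<close>

lemma word_perm_as_gen_product:
  assumes "set u \<subseteq> {1..<n}"
  shows "\<exists>us. length us = count_non1 u \<and> set us \<subseteq> (\<Union>i\<in>{1..n - 2}. {[1, Suc i], [Suc i, 1]}) \<and>
    (if e then adj_transp 1 else id) \<circ> word_perm u
    = word_perm (concat us) \<circ> (if e \<longleftrightarrow> even (length u) then adj_transp 1 else id)"
  using assms
proof (induction u arbitrary: e)
  case Nil
  then show ?case by (intro exI[of _ "[]"]) auto
next
  case (Cons j u)
  from Cons.prems have j: "1 \<le> j" "j < n" and u: "set u \<subseteq> {1..<n}" by auto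
  have cancel: "adj_transp j \<circ> (adj_transp j \<circ> f) = f" for j and f :: "nat \<Rightarrow> nat"
    by (simp flip: comp_assoc)
  from Cons.IH[OF u, of "\<not> e"] obtain us where us: "length us = count_non1 u"
      "set us \<subseteq> (\<Union>i\<in>{1..n - 2}. {[1, Suc i], [Suc i, 1]})"
      "(if \<not> e then adj_transp 1 else id) \<circ> word_perm u
       = word_perm (concat us) \<circ> (if \<not> e \<longleftrightarrow> even (length u) then adj_transp 1 else id)"
    by blast
  have flag: "(\<not> e \<longleftrightarrow> even (length u)) = (e \<longleftrightarrow> even (length (j # u)))" by auto
  show ?case
  proof (cases "j = 1")
    case True
    have "(if e then adj_transp 1 else id) \<circ> word_perm (j # u)
          = (if \<not> e then adj_transp 1 else id) \<circ> word_perm u"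
      using True by (simp add: cancel)
    then show ?thesis using us flag True by (intro exI[of _ us]) auto
  next
    case False
    define g where "g = (if e then [1, j] else [j, 1])"
    have "(if e then adj_transp 1 else id) \<circ> word_perm (j # u)
          = word_perm g \<circ> ((if \<not> e then adj_transp 1 else id) \<circ> word_perm u)"
      by (simp add: g_def comp_assoc cancel)
    also have "\<dots> = word_perm (concat (g # us)) \<circ>
        (if e \<longleftrightarrow> even (length (j # u)) then adj_transp 1 else id)"
      unfolding us(3) flag by (simp add: comp_assoc)
    finally have eq: "(if e then adj_transp 1 else id) \<circ> word_perm (j # u)
      = word_perm (concat (g # us)) \<circ>
        (if e \<longleftrightarrow> even (length (j # u)) then adj_transp 1 else id)" .
    have "j - 1 \<in> {1..n - 2}" "Suc (j - 1) = j" using False j by auto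
    then have "g \<in> (\<Union>i\<in>{1..n - 2}. {[1, Suc i], [Suc i, 1]})"
      unfolding g_def by (intro UN_I[of "j - 1"]) auto
    then have "set (g # us) \<subseteq> (\<Union>i\<in>{1..n - 2}. {[1, Suc i], [Suc i, 1]})"
      using us(2) by simp
    moreover have "length (g # us) = count_non1 (j # u)" using us(1) False by simp
    ultimately show ?thesis using eq by blast
  qed
qed

lemma is_product_of_alt_gens_iff:
  "is_product_of (alt_group n) (alt_gen ` {1..n - 2}) r p \<longleftrightarrow>
    (\<exists>us. length us = r \<and> set us \<subseteq> (\<Union>i\<in>{1..n - 2}. {[1, Suc i], [Suc i, 1]}) \<and>
          word_perm (concat us) = p)"
proof -
  let ?W = "\<Union>i\<in>{1..n - 2}. {[1, Suc i], [Suc i, 1]}"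
  have "is_product_of (alt_group n) (alt_gen ` {1..n - 2}) r p \<longleftrightarrow>
      (\<exists>xs\<in>lists (word_perm ` ?W). length xs = r \<and> foldr (\<circ>) xs id = p)"
    unfolding is_product_of_def alt_gens_with_inverses alt_group_mult alt_group_one lists_eq_set
    by blast
  also have "\<dots> \<longleftrightarrow> (\<exists>us\<in>lists ?W. length us = r \<and> word_perm (concat us) = p)"
    by (simp only: lists_image bex_simps length_map word_perm_concat)
  also have "\<dots> \<longleftrightarrow> (\<exists>us. length us = r \<and> set us \<subseteq> ?W \<and> word_perm (concat us) = p)"
    unfolding lists_eq_set by blast
  finally show ?thesis .
qed

lemma concat_gen_words:
  assumes "set us \<subseteq> (\<Union>i\<in>{1..n - 2}. {[1, Suc i], [Suc i, 1]})"
  shows "set (concat us) \<subseteq> {1..<n} \<and> count_non1 (concat us) = length us"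
  using assms by (induction us) auto

theorem proposition2p2:
  fixes n :: nat and p :: "nat \<Rightarrow> nat"
  assumes "p \<in> carrier (alt_group n)"
  shows "has_gen_length (alt_group n) (alt_gen ` {1..n - 2}) p (two_length n p)"
  unfolding has_gen_length_def
proof (intro conjI allI impI)
  have p: "p permutes {1..n}" "evenperm p" using assms by (simp_all add: alt_group_carrier)
  let ?c = "canonical_word n p"
  have c: "is_canonical_word n p ?c" using p by (intro canonical_word_canonical)
  then have wp: "word_perm ?c = p" by (rule word_perm_canonical)
  then have "even (length ?c)" using evenperm_word_perm[of ?c] p by simp
  then show "is_product_of (alt_group n) (alt_gen ` {1..n - 2}) (two_length n p) p"
    unfolding is_product_of_alt_gens_iff two_length_def
    using word_perm_as_gen_product[OF set_canonical_word[OF c], of False] wp by auto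
next
  fix r assume "is_product_of (alt_group n) (alt_gen ` {1..n - 2}) r p"
  then obtain us where us: "length us = r"
      "set us \<subseteq> (\<Union>i\<in>{1..n - 2}. {[1, Suc i], [Suc i, 1]})" "word_perm (concat us) = p"
    unfolding is_product_of_alt_gens_iff by blast
  then show "two_length n p \<le> r"
    using two_length_le_count_non1[of "concat us" n] concat_gen_words[OF us(2)] by simp
qed

end
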